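(* Let $L>0$ and $T>0$. If $f\in\mathcal R_T^L(0)$, then $f\in\mathcal H$ and $$|f(x)|\le\frac L{2\pi}e^{-\frac{|x|^2}{4T}}\ln\left(1+\frac{4T}{|x|^2}\right),\quad x\in\mathbb R^2\setminus\{0\}.$$
   Context: $\mathbb R_+=(0,+\infty)$; function spaces are complex. $\mathcal H=\{f\in L^2(\mathbb R^2): \exists g\in L^2(\mathbb R_+),\ f(x)=g(|x|^2)\text{ a.e. on }\mathbb R^2\}$. $\mathcal R_T^L(0)$ is the set of functions on $\mathbb R^2$ of the form $$\mathcal W_u(x,T)=-\frac1\pi\int_0^T\frac1{2\xi}e^{-\frac{|x|^2}{4\xi}}u(T-\xi)\,d\xi$$ with $u\in L^\infty(0,T)$, $\|u\|_{L^\infty(0,T)}\le L$ (the states at time $T$ reachable from $0$ for the system $W_t=\Delta W-2\delta u(t)$ on $\mathbb R^2$ by such controls); elements are regarded as elements of $L^2(\mathbb R^2)$, represented for $x\neq0$ by this formula. *)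

theory Defs
  imports "HOL-Analysis.Analysis" "HOL-Probability.Essential_Supremum"
begin

text \<open>
  Elements of the function spaces below are represented by total functions, and equality in
  $L^2$ is equality almost everywhere.
\<close>

definition L2_space :: "'a measure \<Rightarrow> ('a \<Rightarrow> complex) set" where
  "L2_space M = {f. f \<in> borel_measurable M \<and> integrable M (\<lambda>x. (norm (f x))\<^sup>2)}"

text \<open>\<^const>\<open>esssup\<close> takes values in a complete linear order, hence the extended reals.\<close>

definition Linf_norm :: "'a measure \<Rightarrow> ('a \<Rightarrow> complex) \<Rightarrow> ereal" where
  "Linf_norm M u = esssup M (\<lambda>t. ereal (norm (u t)))"

definition Linf_space :: "'a measure \<Rightarrow> ('a \<Rightarrow> complex) set" where
  "Linf_space M = {u. u \<in> borel_measurable M \<and> Linf_norm M u < \<infinity>}"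

definition H_space :: "(real ^ 2 \<Rightarrow> complex) set" where
  "H_space = {f \<in> L2_space lebesgue.
     \<exists>g \<in> L2_space (lebesgue_on {0<..}). AE x in lebesgue. f x = g ((norm x)\<^sup>2)}"

definition W_state :: "(real \<Rightarrow> complex) \<Rightarrow> real ^ 2 \<Rightarrow> real \<Rightarrow> complex" where
  "W_state u x T = - (1 / complex_of_real pi) *
     (LINT \<xi>:{0<..<T}|lebesgue.
        complex_of_real (1 / (2 * \<xi>) * exp (- ((norm x)\<^sup>2 / (4 * \<xi>)))) * u (T - \<xi>))"

text \<open>
  The integral may diverge at $x = 0$ (where the library integral would return $0$), so the value
  of a representative at the origin is left unconstrained.
\<close>

definition reachable_from_zero :: "real \<Rightarrow> real \<Rightarrow> (real ^ 2 \<Rightarrow> complex) set" where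
  "reachable_from_zero L T = {f. \<exists>u \<in> Linf_space (lebesgue_on {0<..<T}).
     Linf_norm (lebesgue_on {0<..<T}) u \<le> ereal L \<and> (\<forall>x. x \<noteq> 0 \<longrightarrow> f x = W_state u x T)}"

end

theory Submission
  imports Defs "HOL-Real_Asymp.Real_Asymp"
begin

text \<open>
  The essential bound on the control reduces the estimate to that of
  $\int_0^T \xi^{-1} e^{-r/(4\xi)}\,d\xi$ with $r = |x|^2$. The integrand is dominated by the
  $\xi$-derivative of $e^{-r/(4\xi)} \ln(1 + 4\xi/r)$, because $\ln(1+s) \ge s/(1+s)$, and this
  function vanishes as $\xi \to 0$. The resulting bound, as a function of $r$, is square integrable on
  $(0,\infty)$; since $|x|^2$ maps Lebesgue measure of the plane to $\pi$ times Lebesgue measure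
  on the half line, this gives square integrability on the half line and on the plane at once.
\<close>

section \<open>Measure theory: completions and the squared norm on the plane\<close>

lemma sigma_finite_completion:
  assumes "sigma_finite_measure M"
  shows "sigma_finite_measure (completion M)"
proof -
  obtain A where A: "countable A" "A \<subseteq> sets M" "\<Union>A = space M" "\<forall>a\<in>A. emeasure M a \<noteq> \<infinity>"
    using sigma_finite_measure.sigma_finite_countable[OF assms] by auto
  have "emeasure (completion M) a \<noteq> \<infinity>" if "a \<in> A" for a
    using A that by (simp add: subset_iff)
  with A show ?thesis
    by unfold_locales (intro exI[of _ A]; auto)
qed

text \<open>Polar coordinates without a Jacobian: a disc of radius \<open>sqrt a\<close> has area
  \<open>pi * a\<close>, so both measures agree on the half lines \<open>{..a}\<close>. These form
  an intersection-stable generator of the Borel sets, and countably many of them, each of finite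
  measure, cover the line.\<close>

lemma distr_norm_power2_lborel:
  "distr lborel borel (\<lambda>x::real^2. (norm x)\<^sup>2) =
   density lborel (\<lambda>r. ennreal pi * indicator {0<..} r)" (is "?M = ?N")
proof (rule measure_eqI_generator_eq[where E = "range atMost" and \<Omega> = UNIV and A = "\<lambda>n. {..real n}"])
  have M: "emeasure ?M {..a} = ennreal (pi * max 0 a)" for a
  proof -
    have "(\<lambda>x::real^2. (norm x)\<^sup>2) -` {..a} = (if a < 0 then {} else cball 0 (sqrt a))"
      by (auto simp: real_le_rsqrt not_less sqrt_ge_absD dest: order_trans[OF zero_le_power2])
    then show ?thesis
      by (auto simp: emeasure_distr emeasure_cball eval_unit_ball_vol mult.commute)
  qed
  have N: "emeasure ?N {..a} = ennreal (pi * max 0 a)" for a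
  proof -
    have "emeasure ?N {..a} = (\<integral>\<^sup>+r. ennreal pi * indicator {0<..a} r \<partial>lborel)"
      by (subst emeasure_density) (auto intro!: nn_integral_cong simp: indicator_def)
    also have "\<dots> = ennreal (pi * max 0 a)"
      by (cases "0 \<le> a") (simp_all add: nn_integral_cmult ennreal_mult)
    finally show ?thesis .
  qed
  show "emeasure ?M X = emeasure ?N X" if "X \<in> range atMost" for X
    using that M N by auto
  show "emeasure ?M {..real n} \<noteq> \<infinity>" for n
    by (simp add: M)
  show "(\<Union>n. {..real n}) = UNIV"
    using real_arch_simple by auto
  show "Int_stable (range (atMost :: real \<Rightarrow> _))"
    by (auto simp: Int_stable_def)
qed (auto simp: borel_eq_atMost)

section \<open>Time integral of the heat kernel and square integrability of its bound\<close>

lemma ln_one_plus_ge: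
  fixes s :: real assumes "s \<ge> 0" shows "s / (1 + s) \<le> ln (1 + s)"
  using ln_diff_le[of 1 "1 + s"] assms by (simp add: field_simps)

lemma heat_kernel_time_integral:
  fixes r T :: real
  assumes "r > 0" "T > 0"
  shows "set_integrable lborel {0<..<T} (\<lambda>t. exp (- (r / (4 * t))) / t)"
    and "(LINT t:{0<..<T}|lborel. exp (- (r / (4 * t))) / t) \<le> exp (- (r / (4 * T))) * ln (1 + 4 * T / r)"
proof -
  \<comment> \<open>\<open>G\<close> is the claimed bound as a function of the upper limit.
    \<open>G'\<close> is its derivative with the kernel factored out, so that only the remaining
    bracket has to be compared with 1.\<close>
  define G where "G = (\<lambda>t. exp (- (r / (4 * t))) * ln (1 + 4 * t / r))"
  define G' where "G' = (\<lambda>t. exp (- (r / (4 * t))) / t * (r / (4 * t) * ln (1 + 4 * t / r) + 4 * t / (r + 4 * t)))"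
  have le: "exp (- (r / (4 * t))) / t \<le> G' t" if "t > 0" for t
  proof -
    \<comment> \<open>With \<open>s = 4 * t / r\<close> the two summands are
      \<open>1 / (1 + s)\<close> and \<open>s / (1 + s)\<close>; replacing
      \<open>s / (1 + s)\<close> by the logarithm in the first one produces the bracket.\<close>
    have "1 = r / (4 * t) * (4 * t / r / (1 + 4 * t / r)) + 4 * t / (r + 4 * t)"
      using that assms by (simp add: divide_simps)
    also have "\<dots> \<le> r / (4 * t) * ln (1 + 4 * t / r) + 4 * t / (r + 4 * t)"
      using that assms by (intro add_right_mono mult_left_mono ln_one_plus_ge) auto
    finally show ?thesis
      using mult_left_mono[of 1 _ "exp (- (r / (4 * t))) / t"] that unfolding G'_def by simp
  qed
  have nonneg: "0 \<le> G' t" if "t > 0" for t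
    using le[OF that] that by (smt (verit) divide_nonneg_pos exp_ge_zero)
  have lim0: "(G \<longlongrightarrow> 0) (at_right 0)"
    unfolding G_def using assms by real_asymp
  have limT: "(G \<longlongrightarrow> G T) (at_left T)"
    unfolding G_def using assms by (intro tendsto_intros) (auto simp: add_pos_pos add_nonneg_eq_0_iff)
  have ge: "(G has_real_derivative G' t) (at t)" if "0 < t" for t
  proof -
    have "1 + 4 * t / r > 0" using that assms by (simp add: add_pos_pos)
    then show ?thesis
    unfolding G_def G'_def using that assms
    by (auto intro!: derivative_eq_intros simp: add_pos_pos)
       (simp add: divide_simps power2_eq_square; simp add: algebra_simps)
  qed
  have cont: "isCont G' t" if "0 < t" for t
  proof -
    have "1 + 4 * t / r > 0" "r + 4 * t > 0" using that assms by (simp_all add: add_pos_pos)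
    then show ?thesis
    unfolding G'_def using that assms by (intro continuous_intros) (auto)
  qed
  \<comment> \<open>For a nonnegative derivative, the one-sided limits of \<open>G\<close> give
    integrability of \<open>G'\<close> as well as its integral, although \<open>G\<close> is not
    defined by a meaningful formula at 0. Integrability of the kernel then follows by
    domination.\<close>
  have ft: "set_integrable lborel (einterval 0 (ereal T)) G'" "(LBINT t=0..ereal T. G' t) = G T - 0"
    by (rule interval_integral_FTC_nonneg[where F = G and A = 0];
        use assms ge cont nonneg lim0 limT in \<open>auto simp: ereal_tendsto_simps zero_ereal_def\<close>)+
  then have int: "set_integrable lborel {0<..<T} G'"
    and eq: "(LINT t:{0<..<T}|lborel. G' t) = G T"
    using assms by (auto simp: interval_lebesgue_integral_def zero_ereal_def)
  show *: "set_integrable lborel {0<..<T} (\<lambda>t. exp (- (r / (4 * t))) / t)"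
    using int by (rule set_integrable_bound)
      (auto simp: set_borel_measurable_def nonneg le)
  show "(LINT t:{0<..<T}|lborel. exp (- (r / (4 * t))) / t) \<le> exp (- (r / (4 * T))) * ln (1 + 4 * T / r)"
    using set_integral_mono[OF * int] le by (simp add: eq) (simp add: G_def)
qed

text \<open>The logarithm grows more slowly than any power. The exponent 1/2 is chosen because at
  \<open>y = 4 * T / r\<close> it leaves the singularity \<open>r powr (- (1/2))\<close>, which is
  integrable at 0.\<close>

lemma ln_one_plus_power2_le:
  fixes y :: real
  assumes "y > 0"
  shows "(ln (1 + y))\<^sup>2 \<le> 16 * y powr (1/2)"
proof -
  \<comment> \<open>With the fourth root, \<open>1 + s ^ 4 \<le> (1 + s) ^ 4\<close> gives
    \<open>ln (1 + y) \<le> 4 * s\<close>; squaring yields the constant 16 and the power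
    \<open>s ^ 2\<close>, the square root of \<open>y\<close>.\<close>
  define s where "s = y powr (1/4)"
  have s: "s > 0" "y = s ^ 4" "y powr (1/2) = s\<^sup>2"
    using assms by (simp_all add: s_def powr_power powr_powr flip: powr_realpow powr_add)
  have "ln (1 + y) \<le> ln ((1 + s) ^ 4)"
    using s(1) by (subst ln_le_cancel_iff) (auto simp: s(2) add_pos_pos eval_nat_numeral algebra_simps)
  also have "\<dots> = 4 * ln (1 + s)"
    using s(1) by (simp add: ln_realpow)
  also have "\<dots> \<le> 4 * s"
    using s(1) by (simp add: ln_add_one_self_le_self)
  finally have "(ln (1 + y))\<^sup>2 \<le> (4 * s)\<^sup>2"
    using assms by (intro power_mono) auto
  then show ?thesis by (simp add: s(3) power_mult_distrib)
qed

lemma square_integrable_exp_ln: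
  fixes T :: real
  assumes "T > 0"
  shows "set_integrable lborel {0<..} (\<lambda>r. (exp (- (r / (4 * T))) * ln (1 + 4 * T / r))\<^sup>2)"
proof -
  \<comment> \<open>This is the Gamma integrand with parameter 1/2 and rate
    \<open>1 / (2 * T)\<close>; squaring the exponential factor doubles its rate
    \<open>1 / (4 * T)\<close>.\<close>
  let ?k = "\<lambda>t. t powr (- (1/2)) / exp (1 / (2 * T) * t)"
  have "set_integrable lebesgue {0<..}
      (\<lambda>t. complex_of_real t powr (of_real (1/2) - 1) / of_real (exp (1 / (2 * T) * t)))"
    using assms by (intro absolutely_integrable_Gamma_integral) auto
  from set_integrable_norm[OF this] have "set_integrable lebesgue {0<..} ?k"
    by (rule set_integrable_cong[THEN iffD1, rotated -1]) (auto simp: norm_divide norm_powr_real_powr)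
  then have "set_integrable lborel {0<..} ?k"
    unfolding set_integrable_def by (subst (asm) integrable_completion) auto
  then have "set_integrable lborel {0<..} (\<lambda>t. 16 * (4 * T) powr (1/2) * ?k t)"
    by (rule set_integrable_mult_right)
  then show ?thesis
  proof (rule set_integrable_bound)
    have "(exp (- (r / (4 * T))) * ln (1 + 4 * T / r))\<^sup>2 \<le> 16 * (4 * T) powr (1/2) * ?k r" if "r > 0" for r
    proof -
      have "(exp (- (r / (4 * T))) * ln (1 + 4 * T / r))\<^sup>2 = exp (- (r / (2 * T))) * (ln (1 + 4 * T / r))\<^sup>2"
        by (simp add: power_mult_distrib flip: exp_double)
      also have "\<dots> \<le> exp (- (r / (2 * T))) * (16 * (4 * T / r) powr (1/2))"
        using that assms by (intro mult_left_mono ln_one_plus_power2_le) auto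
      also have "\<dots> = 16 * (4 * T) powr (1/2) * ?k r"
        using that assms by (simp add: powr_divide powr_minus_divide exp_minus field_simps)
      finally show ?thesis .
    qed
    then show "AE x in lborel. x \<in> {0<..} \<longrightarrow> norm ((exp (- (x / (4 * T))) * ln (1 + 4 * T / x))\<^sup>2)
        \<le> norm (16 * (4 * T) powr (1/2) * ?k x)"
      by simp
  qed (simp add: set_borel_measurable_def)
qed

section \<open>The control and the potential generated by it\<close>

lemma distr_lebesgue_reflect:
  "distr lebesgue lebesgue (\<lambda>x. a - x) = (lebesgue :: real measure)"
  using lebesgue_real_affine[of "-1" a] by (simp add: density_1)

lemma measurable_lebesgue_reflect: "(\<lambda>x::real. a - x) \<in> lebesgue \<rightarrow>\<^sub>M lebesgue"
  using lebesgue_affine_measurable[of "\<lambda>_. -1" a] by simp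

text \<open>The reflection at \<open>T / 2\<close> maps the interval to itself and preserves
  Lebesgue measure, so measurability and the essential bound pass to the time-reversed control that
  occurs in \<open>W_state\<close>.\<close>

lemma reflect_control:
  fixes u :: "real \<Rightarrow> complex"
  assumes u: "u \<in> Linf_space (lebesgue_on {0<..<T})"
    and L: "Linf_norm (lebesgue_on {0<..<T}) u \<le> ereal L"
  shows "(\<lambda>t. u (T - t)) \<in> borel_measurable (lebesgue_on {0<..<T})"
    and "AE t in lebesgue_on {0<..<T}. norm (u (T - t)) \<le> L"
proof -
  have "(\<lambda>t. T - t) \<in> lebesgue_on {0<..<T} \<rightarrow>\<^sub>M lebesgue_on {0<..<T}"
    by (intro measurable_restrict_space3 measurable_lebesgue_reflect) auto
  from measurable_compose[OF this] u
  show "(\<lambda>t. u (T - t)) \<in> borel_measurable (lebesgue_on {0<..<T})"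
    by (auto simp: Linf_space_def)
  have "AE t in lebesgue_on {0<..<T}. norm (u t) \<le> L"
    using esssup_AE[of "\<lambda>t. ereal (norm (u t))" "lebesgue_on {0<..<T}"] L
    by (auto simp: Linf_norm_def elim!: eventually_mono dest: order_trans)
  then have "AE t in lebesgue. t \<in> {0<..<T} \<longrightarrow> norm (u t) \<le> L"
    by (simp add: AE_restrict_space_iff)
  then have "AE t in lebesgue. T - t \<in> {0<..<T} \<longrightarrow> norm (u (T - t)) \<le> L"
    by (intro AE_distrD[OF measurable_lebesgue_reflect]) (simp only: distr_lebesgue_reflect)
  then show "AE t in lebesgue_on {0<..<T}. norm (u (T - t)) \<le> L"
    by (auto simp: AE_restrict_space_iff elim!: eventually_mono)
qed

lemma norm_heat_potential_le:
  fixes v :: "real \<Rightarrow> complex"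
  assumes "r > 0" "T > 0"
    and L: "AE t in lebesgue_on {0<..<T}. norm (v t) \<le> L"
  shows "norm (LINT t:{0<..<T}|lebesgue. complex_of_real (1 / (2 * t) * exp (- (r / (4 * t)))) * v t)
    \<le> L / 2 * (exp (- (r / (4 * T))) * ln (1 + 4 * T / r))" (is "norm ?I \<le> _")
proof -
  let ?M = "lebesgue_on {0<..<T}"
  let ?k = "\<lambda>t. exp (- (r / (4 * t))) / t"
  \<comment> \<open>A negative essential bound on a norm would make the interval, which has length
    \<open>T > 0\<close>, a null set.\<close>
  have L0: "L \<ge> 0"
  proof (rule ccontr)
    assume "\<not> L \<ge> 0"
    then have "AE t in ?M. False"
      using L by (auto elim!: eventually_mono) (smt (verit) norm_ge_zero)
    then have "{0<..<T} \<in> null_sets lebesgue"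
      by (simp add: AE_iff_null null_sets_restrict_space del: greaterThanLessThan_iff)
    then show False using assms by (auto dest: null_setsD1)
  qed
  have k: "set_integrable lebesgue {0<..<T} ?k"
     and k_eq: "(LINT t:{0<..<T}|lebesgue. ?k t) = (LINT t:{0<..<T}|lborel. ?k t)"
    using heat_kernel_time_integral(1)[OF assms(1,2)]
    unfolding set_integrable_def set_lebesgue_integral_def
    by (subst integrable_completion integral_completion; force)+
  have Lk: "integrable ?M (\<lambda>t. L / 2 * ?k t)"
    by (rule integrable_mult_right) (use k in \<open>simp add: integrable_restrict_space set_integrable_def\<close>)
  have "?I = (LINT t|?M. complex_of_real (1 / (2 * t) * exp (- (r / (4 * t)))) * v t)"
    by (simp add: integral_restrict_space set_lebesgue_integral_def)
  also have "norm \<dots> \<le> (LINT t|?M. L / 2 * ?k t)"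
  \<comment> \<open>The majorant is integrable and nonnegative, so the comparison also covers the
    default value 0 of an integral on the left.\<close>
  proof (rule integral_norm_bound[THEN order_trans], rule integral_mono_AE'[OF Lk])
    show "AE t in ?M. norm (complex_of_real (1 / (2 * t) * exp (- (r / (4 * t)))) * v t) \<le> L / 2 * ?k t"
      using L AE_space
    proof eventually_elim
      case (elim t)
      then have "t > 0" by simp
      then have "?k t / 2 * norm (v t) \<le> ?k t / 2 * L"
        using elim by (intro mult_left_mono) auto
      then show ?case using \<open>t > 0\<close> by (simp add: norm_mult norm_divide mult_ac)
    qed
  qed (use L0 in \<open>auto intro!: AE_I2\<close>)
  also have "\<dots> = L / 2 * (LINT t:{0<..<T}|lborel. ?k t)"
    unfolding k_eq[symmetric]
    by (subst integral_mult_right_zero) (simp add: integral_restrict_space set_lebesgue_integral_def)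
  also have "\<dots> \<le> L / 2 * (exp (- (r / (4 * T))) * ln (1 + 4 * T / r))"
    using L0 by (intro mult_left_mono heat_kernel_time_integral(2) assms) auto
  finally show ?thesis .
qed

text \<open>The integrand is jointly measurable in \<open>r\<close> and \<open>t\<close>, so
  integrating out \<open>t\<close> over a sigma-finite measure leaves a measurable function of
  \<open>r\<close>. Borel rather than Lebesgue measurability in \<open>r\<close> permits composition
  with the squared norm later.\<close>

lemma borel_measurable_heat_potential:
  fixes v :: "real \<Rightarrow> complex"
  assumes v: "v \<in> borel_measurable (lebesgue_on {0<..<T})"
  shows "(\<lambda>r. LINT t:{0<..<T}|lebesgue. complex_of_real (1 / (2 * t) * exp (- (r / (4 * t)))) * v t)
    \<in> borel_measurable borel"
proof -
  \<comment> \<open>Extending \<open>v\<close> by zero turns the integral over the interval into one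
    over the whole line.\<close>
  have v': "(\<lambda>t. indicator {0<..<T} t *\<^sub>R v t) \<in> borel_measurable lebesgue"
    using v by (simp add: borel_measurable_restrict_space_iff)
  interpret sigma_finite_measure "lebesgue :: real measure"
    by (rule sigma_finite_completion) (rule lborel.sigma_finite_measure_axioms)
  have [measurable]: "(\<lambda>p. snd p) \<in> borel_measurable (borel \<Otimes>\<^sub>M (lebesgue :: real measure))"
    by (rule measurable_compose[OF measurable_snd]) (simp add: measurable_completion)
  have [measurable]: "(\<lambda>p. indicator {0<..<T} (snd p) *\<^sub>R v (snd p)) \<in> borel_measurable (borel \<Otimes>\<^sub>M lebesgue)"
    by (rule measurable_compose[OF measurable_snd v'])
  have "(\<lambda>r. LINT t|lebesgue. complex_of_real (1 / (2 * t) * exp (- (r / (4 * t)))) * (indicator {0<..<T} t *\<^sub>R v t))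
    \<in> borel_measurable borel"
    by (rule borel_measurable_lebesgue_integral)
       (unfold split_beta', intro borel_measurable_times, measurable)
  then show ?thesis
    by (simp add: set_lebesgue_integral_def scaleR_conv_of_real mult_ac)
qed

section \<open>Radial functions on the plane and the conclusion\<close>

lemma radial_mem_H_space:
  fixes g :: "real \<Rightarrow> complex" and f :: "real ^ 2 \<Rightarrow> complex"
  assumes g [measurable]: "g \<in> borel_measurable borel"
    and int: "set_integrable lborel {0<..} (\<lambda>r. (norm (g r))\<^sup>2)"
    and f: "\<And>x. x \<noteq> 0 \<Longrightarrow> f x = g ((norm x)\<^sup>2)"
  shows "f \<in> H_space"
proof -
  have AE: "AE x in lebesgue. f x = g ((norm x)\<^sup>2)"
    by (rule AE_completion) (rule AE_mp[OF AE_lborel_singleton[of 0]], simp add: f)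
  have gm: "(\<lambda>x::real^2. g ((norm x)\<^sup>2)) \<in> borel_measurable lborel"
    by simp
  \<comment> \<open>The weight is the density of the image of planar measure under the squared norm,
    so this is already the planar integrability statement in the variable \<open>r\<close>.\<close>
  have "integrable lborel (\<lambda>r. (pi * indicator {0<..} r) *\<^sub>R (norm (g r))\<^sup>2)"
    using integrable_mult_right[OF int[unfolded set_integrable_def], of pi] by (simp add: mult_ac)
  then have "integrable (density lborel (\<lambda>r. ennreal (pi * indicator {0<..} r))) (\<lambda>r. (norm (g r))\<^sup>2)"
    by (subst integrable_density) auto
  also have "(\<lambda>r. ennreal (pi * indicator {0<..} r)) = (\<lambda>r. ennreal pi * indicator {0<..} r)"
    by (auto simp: indicator_def)
  finally have "integrable (distr lborel borel (\<lambda>x::real^2. (norm x)\<^sup>2)) (\<lambda>r. (norm (g r))\<^sup>2)"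
    by (simp only: distr_norm_power2_lborel)
  then have "integrable lborel (\<lambda>x::real^2. (norm (g ((norm x)\<^sup>2)))\<^sup>2)"
    by (subst (asm) integrable_distr_eq) auto
  then have "integrable lebesgue (\<lambda>x::real^2. (norm (g ((norm x)\<^sup>2)))\<^sup>2)"
    by (subst integrable_completion) auto
  moreover have "f \<in> borel_measurable lebesgue"
  proof -
    \<comment> \<open>The value at the origin is arbitrary; changing a Borel function at one point
      keeps it Borel.\<close>
    have "f = (\<lambda>x. if x = 0 then f 0 else g ((norm x)\<^sup>2))"
      using f by auto
    also have "\<dots> \<in> borel_measurable lborel"
      using gm by measurable
    finally show ?thesis by (rule measurable_completion)
  qed
  ultimately have "f \<in> L2_space lebesgue"
    using AE unfolding L2_space_def mem_Collect_eq
    by (auto intro: integrable_cong_AE_imp elim!: eventually_mono)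
  moreover have "g \<in> L2_space (lebesgue_on {0<..})"
  proof -
    have "g \<in> borel_measurable lborel" by simp
    then have "g \<in> borel_measurable (lebesgue_on {0<..})"
      by (intro measurable_restrict_space1 measurable_completion)
    then show ?thesis
      using int unfolding L2_space_def set_integrable_def
      by (auto simp: integrable_restrict_space integrable_completion)
  qed
  ultimately show ?thesis
    using AE by (auto simp: H_space_def)
qed

theorem theorem3p6:
  fixes L T :: real and f :: "real ^ 2 \<Rightarrow> complex"
  assumes "L > 0" and "T > 0"
    and "f \<in> reachable_from_zero L T"
  shows "f \<in> H_space \<and>
    (\<forall>x. x \<noteq> 0 \<longrightarrow>
      norm (f x) \<le> L / (2 * pi) * exp (- ((norm x)\<^sup>2 / (4 * T))) * ln (1 + 4 * T / (norm x)\<^sup>2))"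
proof -
  obtain u where u: "u \<in> Linf_space (lebesgue_on {0<..<T})" "Linf_norm (lebesgue_on {0<..<T}) u \<le> ereal L"
    and f: "\<And>x. x \<noteq> 0 \<Longrightarrow> f x = W_state u x T"
    using assms(3) by (auto simp: reachable_from_zero_def)
  note v = reflect_control[OF u]
  \<comment> \<open>The radial profile: the formula of \<open>W_state\<close> with \<open>r\<close>
    in place of the squared norm.\<close>
  define g where "g r = - (1 / complex_of_real pi) *
    (LINT t:{0<..<T}|lebesgue. complex_of_real (1 / (2 * t) * exp (- (r / (4 * t)))) * u (T - t))" for r
  define b where "b r = exp (- (r / (4 * T))) * ln (1 + 4 * T / r)" for r
  have fg: "f x = g ((norm x)\<^sup>2)" if "x \<noteq> 0" for x
    using f[OF that] by (simp add: W_state_def g_def)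
  \<comment> \<open>The factor \<open>L / 2\<close> from the kernel estimate and the prefactor
    \<open>1 / pi\<close> combine to \<open>L / (2 * pi)\<close>.\<close>
  have g_le: "norm (g r) \<le> L / (2 * pi) * b r" if "r > 0" for r
    using mult_left_mono[OF norm_heat_potential_le[OF that \<open>T > 0\<close> v(2)], of "1 / pi"]
    by (simp add: g_def b_def norm_mult norm_divide)
  have g_meas [measurable]: "g \<in> borel_measurable borel"
    unfolding g_def by (intro borel_measurable_times borel_measurable_const borel_measurable_heat_potential v(1))
  have "set_integrable lborel {0<..} (\<lambda>r. (L / (2 * pi))\<^sup>2 * (b r)\<^sup>2)"
    unfolding b_def by (intro set_integrable_mult_right square_integrable_exp_ln \<open>T > 0\<close>)
  then have "set_integrable lborel {0<..} (\<lambda>r. (norm (g r))\<^sup>2)"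
  proof (rule set_integrable_bound)
    have "(norm (g r))\<^sup>2 \<le> (L / (2 * pi))\<^sup>2 * (b r)\<^sup>2" if "r > 0" for r
      using power_mono[OF g_le[OF that] norm_ge_zero, of 2] by (simp only: power_mult_distrib)
    then show "AE r in lborel. r \<in> {0<..} \<longrightarrow> norm ((norm (g r))\<^sup>2) \<le> norm ((L / (2 * pi))\<^sup>2 * (b r)\<^sup>2)"
      by simp
  qed (simp add: set_borel_measurable_def)
  then have "f \<in> H_space"
    using g_meas fg by (intro radial_mem_H_space)
  moreover have "norm (f x) \<le> L / (2 * pi) * exp (- ((norm x)\<^sup>2 / (4 * T))) * ln (1 + 4 * T / (norm x)\<^sup>2)"
    if "x \<noteq> 0" for x
    using g_le[of "(norm x)\<^sup>2"] that by (simp add: fg b_def mult.assoc)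
  ultimately show ?thesis by blast
qed

end
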